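(* Let $p>0$ be an integer. The generating function $G(x)=\sum_{n=0}^{\infty}\mathbb{Q}\mathcal{R}_{p,n}x^{n}$ of the Lucas-Leonardo $p$-quaternions is $$G(x)=\frac{I+p(p+1)+\sum_{n=1}^{p}\left(\mathbb{Q}\mathcal{R}_{p,n}-\mathbb{Q}\mathcal{R}_{p,n-1}\right)x^{n}+pI\,\frac{x^{p+1}}{1-x}}{1-x-x^{p+1}}.$$
   Context: For an integer $p>0$, the Lucas-Leonardo $p$-numbers $\mathcal{R}_{p,n}$ ($n\geq 0$) are the integers defined by $\mathcal{R}_{p,0}=p^{2}+p+1$, $\mathcal{R}_{p,1}=\cdots=\mathcal{R}_{p,p}=1$ and $\mathcal{R}_{p,n}=\mathcal{R}_{p,n-1}+\mathcal{R}_{p,n-p-1}+p$ for $n>p$. Work in the real quaternion algebra with basis $1,i,j,k$ ($i^2=j^2=-1$, $ij=-ji=k$). The $n$-th Lucas-Leonardo $p$-quaternion is $\mathbb{Q}\mathcal{R}_{p,n}=\mathcal{R}_{p,n}+\mathcal{R}_{p,n+1}i+\mathcal{R}_{p,n+2}j+\mathcal{R}_{p,n+3}k$. Notation: $I=1+i+j+k$. The identity is one of formal power series in a variable $x$ (commuting with all quaternions) with real quaternion coefficients; division by $1-x$ and by $1-x-x^{p+1}$ means multiplication by their inverses as real formal power series.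
   Formalization: The printed formula fails for p = 1 and p = 2 (the constant term of G is QR_{p,0}, not I + p(p+1)); it is proved as printed for p ≥ 3, and for all p > 0 with I + p(p+1) replaced by QR_{p,0}. *)

theory Defs
  imports Complex_Main "HOL-Computational_Algebra.Formal_Power_Series"
begin

fun lucas_leonardo :: "nat \<Rightarrow> nat \<Rightarrow> int" where
  "lucas_leonardo p n =
     (if n = 0 then int p ^ 2 + int p + 1
      else if n \<le> p then 1
      else lucas_leonardo p (n - 1) + lucas_leonardo p (n - p - 1) + int p)"

declare lucas_leonardo.simps [simp del]

datatype quat = Quat (qRe: real) (qIm1: real) (qIm2: real) (qIm3: real)

lemma quat_eqI:
  "\<lbrakk>qRe x = qRe y; qIm1 x = qIm1 y; qIm2 x = qIm2 y; qIm3 x = qIm3 y\<rbrakk> \<Longrightarrow> x = y"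
  by (rule quat.expand) auto

instantiation quat :: real_algebra_1
begin

definition zero_quat where "zero_quat = Quat 0 0 0 0"

definition one_quat where "one_quat = Quat 1 0 0 0"

definition plus_quat where
  "x + y = Quat (qRe x + qRe y) (qIm1 x + qIm1 y) (qIm2 x + qIm2 y) (qIm3 x + qIm3 y)"

definition uminus_quat where
  "- x = Quat (- qRe x) (- qIm1 x) (- qIm2 x) (- qIm3 x)"

definition minus_quat where
  "x - y = Quat (qRe x - qRe y) (qIm1 x - qIm1 y) (qIm2 x - qIm2 y) (qIm3 x - qIm3 y)"

definition scaleR_quat where
  "r *\<^sub>R x = Quat (r * qRe x) (r * qIm1 x) (r * qIm2 x) (r * qIm3 x)"

definition times_quat where
  "x * y = Quat
     (qRe x * qRe y - qIm1 x * qIm1 y - qIm2 x * qIm2 y - qIm3 x * qIm3 y)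
     (qRe x * qIm1 y + qIm1 x * qRe y + qIm2 x * qIm3 y - qIm3 x * qIm2 y)
     (qRe x * qIm2 y - qIm1 x * qIm3 y + qIm2 x * qRe y + qIm3 x * qIm1 y)
     (qRe x * qIm3 y + qIm1 x * qIm2 y - qIm2 x * qIm1 y + qIm3 x * qRe y)"

instance
  by standard
    (auto intro!: quat_eqI simp: zero_quat_def one_quat_def plus_quat_def uminus_quat_def
      minus_quat_def scaleR_quat_def times_quat_def algebra_simps)

end

definition quat_i :: quat where "quat_i = Quat 0 1 0 0"
definition quat_j :: quat where "quat_j = Quat 0 0 1 0"
definition quat_k :: quat where "quat_k = Quat 0 0 0 1"

lemma quat_basis_mult:
  "quat_i * quat_i = - 1" "quat_j * quat_j = - 1"
  "quat_i * quat_j = quat_k" "quat_j * quat_i = - quat_k"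
  by (simp_all add: quat_i_def quat_j_def quat_k_def times_quat_def uminus_quat_def one_quat_def)

lemma Quat_eq_basis:
  "Quat a b c d = of_real a + of_real b * quat_i + of_real c * quat_j + of_real d * quat_k"
  by (simp add: of_real_def quat_i_def quat_j_def quat_k_def times_quat_def plus_quat_def
      scaleR_quat_def one_quat_def)

definition quat_I :: quat where "quat_I = 1 + quat_i + quat_j + quat_k"

definition lucas_leonardo_quat :: "nat \<Rightarrow> nat \<Rightarrow> quat" where
  "lucas_leonardo_quat p n =
     of_int (lucas_leonardo p n) + of_int (lucas_leonardo p (n + 1)) * quat_i
     + of_int (lucas_leonardo p (n + 2)) * quat_j + of_int (lucas_leonardo p (n + 3)) * quat_k"

text \<open>The inclusion of real formal power series in those with quaternion coefficients; quotients
  by real power series are formed over the reals, where power series inversion is available.\<close>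

definition quat_fps_of_real :: "real fps \<Rightarrow> quat fps" where
  "quat_fps_of_real F = Abs_fps (\<lambda>n. of_real (fps_nth F n))"

text \<open>The constant term of the generating function is \<open>p\<^sup>2 + p + 1\<close> plus the imaginary part with
  coefficients the Lucas-Leonardo \<open>p\<close>-numbers of index 1, 2, 3. These are all 1 only for
  \<open>p \<ge> 3\<close>, so \<open>quat_I + p (p + 1)\<close> is the constant term for \<open>p \<ge> 3\<close> but not for
  \<open>p = 1, 2\<close>.\<close>

definition lucas_leonardo_quat_gf :: "nat \<Rightarrow> quat fps" where
  "lucas_leonardo_quat_gf p = Abs_fps (\<lambda>n. lucas_leonardo_quat p n)"

end

theory Submission
  imports Defs
begin

text \<open>
  Each of the four components of the Lucas-Leonardo quaternion \<open>Q\<^sub>n\<close> obeys the recurrence of the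
  integer sequence, shifted by 0, 1, 2 or 3. The recurrence is valid at every index above \<open>p\<close>, so
  it holds for all four components at once as soon as \<open>n > p\<close>, and its constant \<open>p\<close> becomes
  \<open>p I\<close>: that is \<open>lucas_leonardo_quat_rec\<close>.

  The coefficient of \<open>x\<^sup>n\<close> in \<open>G(x) (1 - x - x\<^bsup>p+1\<^esup>)\<close> is \<open>Q\<^sub>n - Q\<^bsub>n-1\<^esub> - Q\<^bsub>n-p-1\<^esub>\<close>, where terms
  with a negative index are dropped. This is \<open>Q\<^sub>0\<close> for \<open>n = 0\<close>, the difference
  \<open>Q\<^sub>n - Q\<^bsub>n-1\<^esub>\<close> for \<open>1 \<le> n \<le> p\<close>, and the constant \<open>p I\<close> for \<open>n > p\<close>; the constant tail sums to
  \<open>p I x\<^bsup>p+1\<^esup> / (1 - x)\<close>. Hence \<open>lucas_leonardo_quat_gf_mult_denominator\<close>. The real series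
  \<open>1 - x - x\<^bsup>p+1\<^esup>\<close> has constant term 1, so it can be inverted over the reals, and because real series
  embed multiplicatively into quaternion series the inverse cancels it there too
  (\<open>eq_mult_quat_fps_of_real_inverse\<close>). Finally \<open>Q\<^sub>0 = I + p (p + 1)\<close> when \<open>p \<ge> 3\<close>, since the entries at
  1, 2 and 3 are then all initial values.
\<close>

lemma quat_fps_of_real_nth [simp]: "fps_nth (quat_fps_of_real F) n = of_real (fps_nth F n)"
  by (simp add: quat_fps_of_real_def)

lemma quat_fps_of_real_1 [simp]: "quat_fps_of_real 1 = 1"
  by (rule fps_ext) simp

lemma quat_fps_of_real_fps_X_power [simp]: "quat_fps_of_real (fps_X ^ k) = fps_X ^ k"
  by (rule fps_ext) (simp add: fps_X_power_nth)

lemma quat_fps_of_real_diff: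
  "quat_fps_of_real (F - G) = quat_fps_of_real F - quat_fps_of_real G"
  by (rule fps_ext) simp

lemma quat_fps_of_real_mult:
  "quat_fps_of_real (F * G) = quat_fps_of_real F * quat_fps_of_real G"
  by (rule fps_ext) (simp add: fps_mult_nth)

text \<open>
  An inverse formed among the real series stays an inverse after the embedding, because the embedding
  is multiplicative and preserves 1.
\<close>

lemma eq_mult_quat_fps_of_real_inverse:
  assumes "A * quat_fps_of_real D = B" and "fps_nth D 0 \<noteq> 0"
  shows "A = B * quat_fps_of_real (inverse D)"
proof -
  have "B * quat_fps_of_real (inverse D) = A * quat_fps_of_real (D * inverse D)"
    by (simp add: assms(1)[symmetric] quat_fps_of_real_mult mult.assoc)
  also have "D * inverse D = 1"
    using assms(2) by (rule inverse_mult_eq_1')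
  finally show ?thesis by simp
qed

lemma lucas_leonardo_0: "lucas_leonardo p 0 = int p ^ 2 + int p + 1"
  by (simp add: lucas_leonardo.simps)

lemma lucas_leonardo_initial:
  assumes "0 < n" "n \<le> p"
  shows "lucas_leonardo p n = 1"
  using assms by (subst lucas_leonardo.simps) simp

lemma lucas_leonardo_rec:
  assumes "p < n"
  shows "lucas_leonardo p n = lucas_leonardo p (n - 1) + lucas_leonardo p (n - p - 1) + int p"
  using assms by (subst lucas_leonardo.simps) simp

lemma lucas_leonardo_quat_rec:
  assumes "p < n"
  shows "lucas_leonardo_quat p n =
    lucas_leonardo_quat p (n - 1) + lucas_leonardo_quat p (n - Suc p) + of_nat p * quat_I"
proof -
  \<comment> \<open>Writing \<open>n\<close> as a sum frees the shifted indices from truncated subtraction.\<close>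
  define m where "m = n - Suc p"
  then have n: "n = m + p + 1"
    using assms by simp
  have rec: "lucas_leonardo p (n + d) =
      lucas_leonardo p (n - 1 + d) + lucas_leonardo p (n - Suc p + d) + int p" for d
    using lucas_leonardo_rec[of p "n + d"] by (simp add: n ac_simps)
  show ?thesis
    by (simp only: lucas_leonardo_quat_def quat_I_def rec rec[of 0, unfolded add_0_right]) (simp add: algebra_simps)
qed

lemma lucas_leonardo_quat_0:
  assumes "3 \<le> p"
  shows "lucas_leonardo_quat p 0 = quat_I + of_nat (p * (p + 1))"
  using assms
  by (simp add: lucas_leonardo_quat_def quat_I_def lucas_leonardo_0 lucas_leonardo_initial
      power2_eq_square algebra_simps)

text \<open>
  The recurrence in generating-function form: multiplying by \<open>1 - x - x\<^bsup>p+1\<^esup>\<close> leaves only the initial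
  values and the inhomogeneous term \<open>p I\<close>.
\<close>

lemma lucas_leonardo_quat_gf_mult_denominator:
  "lucas_leonardo_quat_gf p * quat_fps_of_real (1 - fps_X - fps_X ^ (p + 1)) =
     fps_const (lucas_leonardo_quat p 0)
     + (\<Sum>n = 1..p. fps_const (lucas_leonardo_quat p n - lucas_leonardo_quat p (n - 1)) * fps_X ^ n)
     + fps_const (of_nat p * quat_I) * quat_fps_of_real (fps_X ^ (p + 1) * inverse (1 - fps_X))"
  (is "?G * _ = _ + ?S + ?T")
proof (rule fps_ext)
  fix m
  let ?Q = "lucas_leonardo_quat p"
  \<comment> \<open>The power \<open>fps_X ^ 1\<close> lets one coefficient rule treat both shifts.\<close>
  have denominator: "?G * quat_fps_of_real (1 - fps_X - fps_X ^ (p + 1)) =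
      ?G - ?G * fps_X ^ 1 - ?G * fps_X ^ (p + 1)"
    using quat_fps_of_real_fps_X_power[of 1]
    by (simp add: quat_fps_of_real_diff right_diff_distrib del: power_Suc)
  have lhs: "fps_nth (?G * quat_fps_of_real (1 - fps_X - fps_X ^ (p + 1))) m =
      ?Q m - (if m < 1 then 0 else ?Q (m - 1)) - (if m < p + 1 then 0 else ?Q (m - (p + 1)))"
    unfolding denominator
    by (simp only: fps_sub_nth fps_X_power_mult_right_nth) (simp add: lucas_leonardo_quat_gf_def)
  have S: "fps_nth ?S m = (if m \<in> {1..p} then ?Q m - ?Q (m - 1) else 0)"
    by (simp add: fps_sum_nth fps_X_power_nth if_distrib[of "(*) _"] cong: if_cong)
  have T: "fps_nth ?T m = (if m \<le> p then 0 else of_nat p * quat_I)"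
    by (simp add: fps_X_power_mult_nth fps_inverse_one_minus_fps_X del: power_Suc)
  show "fps_nth (?G * quat_fps_of_real (1 - fps_X - fps_X ^ (p + 1))) m =
      fps_nth (fps_const (?Q 0) + ?S + ?T) m"
  proof (cases "m \<le> p")
    case True
    then show ?thesis
      unfolding lhs fps_add_nth S T by (cases m) auto
  next
    case False
    then show ?thesis
      unfolding lhs fps_add_nth S T using lucas_leonardo_quat_rec[of p m] by simp
  qed
qed

theorem proposition1:
  fixes p :: nat
  assumes "p > 0"
  shows
    "(p \<ge> 3 \<longrightarrow>
        lucas_leonardo_quat_gf p =
          (fps_const (quat_I + of_nat (p * (p + 1)))
           + (\<Sum>n = 1..p. fps_const (lucas_leonardo_quat p n - lucas_leonardo_quat p (n - 1)) * fps_X ^ n)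
           + fps_const (of_nat p * quat_I) * quat_fps_of_real (fps_X ^ (p + 1) * inverse (1 - fps_X)))
          * quat_fps_of_real (inverse (1 - fps_X - fps_X ^ (p + 1))))
     \<and> lucas_leonardo_quat_gf p =
          (fps_const (lucas_leonardo_quat p 0)
           + (\<Sum>n = 1..p. fps_const (lucas_leonardo_quat p n - lucas_leonardo_quat p (n - 1)) * fps_X ^ n)
           + fps_const (of_nat p * quat_I) * quat_fps_of_real (fps_X ^ (p + 1) * inverse (1 - fps_X)))
          * quat_fps_of_real (inverse (1 - fps_X - fps_X ^ (p + 1)))"
proof -
  have "fps_nth (1 - fps_X - fps_X ^ (p + 1) :: real fps) 0 \<noteq> 0"
    by simp
  note gf = eq_mult_quat_fps_of_real_inverse[OF lucas_leonardo_quat_gf_mult_denominator this]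
  show ?thesis (is "(_ \<longrightarrow> _ = (_ + ?S + ?T) * ?D) \<and> _")
  proof (intro conjI impI)
    assume "p \<ge> 3"
    show "lucas_leonardo_quat_gf p = (fps_const (quat_I + of_nat (p * (p + 1))) + ?S + ?T) * ?D"
      unfolding lucas_leonardo_quat_0[OF \<open>p \<ge> 3\<close>, symmetric] by (rule gf)
  qed (rule gf)
qed

end
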